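(* Let $d:E_d\to[0,\infty)$ be a floppy graph metric with vertex set $V_d$ and let $\mathcal T$ be the family of all nonempty open subsets of $(0,\infty)$. If the cardinal $\lambda=|[V_d]^2\setminus E_d|$ is at most countable, then player I has a winning strategy in the metric-extending game $\Game_d(\lambda,\mathcal T)$.
   Context: Notation: $[X]^2=\{A\subseteq X:|A|=2\}$; $xy$ denotes $\{x,y\}$. A graph is a set $E$ of 2-element sets with vertex set $\bigcup E$; it is connected if any two vertices are joined by a finite path of edges. For a function $d:E_d\to[0,\infty)$ on a connected graph $E_d$ with vertex set $V_d$: $\hat d(x,y)=\inf\{\sum_{i=1}^n d(x_{i-1}x_i): x_0=x,\ x_n=y,\ x_{i-1}x_i\in E_d\}$ (and $\hat d(x,x)=0$); $\check d(x,y)=\sup_{ab\in E_d}\max\{0,d(ab)-\hat d(a,x)-\hat d(y,b)\}$. A graph pseudometric is such a $d$ satisfying $d(xy)=\hat d(x,y)$ for every $xy\in E_d$ (polygonal inequality); a graph metric is a graph pseudometric with $d(xy)>0$ for all $xy\in E_d$; a full metric is a graph metric with $E_d=[V_d]^2$. A graph pseudometric is floppy if $\check d(x,y)<\hat d(x,y)$ whenever $xy\in[V_d]^2\setminus E_d$. The metric-extending game $\Game_d(\lambda,\mathcal F)$ (for a graph metric $d$, an ordinal $\lambda$ and a family $\mathcal F$ of nonempty subsets of $\mathbb R$) has innings indexed by $\alpha\in\lambda$: at inning $\alpha$ player I chooses a doubleton $x_\alpha y_\alpha\in[V_d]^2$ and a set $F_\alpha\in\mathcal F$, and player II answers with a real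 number $r_\alpha\in F_\alpha$. Player I wins the play if the relation $D=d\cup\{\langle x_\alpha y_\alpha,r_\alpha\rangle:\alpha\in\lambda\}$ is a full metric (in particular a function on $[V_d]^2$); otherwise player II wins. A strategy of player I is a rule assigning to each transfinite sequence $(r_\gamma)_{\gamma<\alpha}$ ($\alpha<\lambda$) of previous answers of player II a move $\langle x_\alpha y_\alpha,F_\alpha\rangle$; it is winning if player I wins every play in which he follows it. *)

theory Defs
  imports Complex_Main "HOL-Library.FuncSet"
begin

unbundle cardinal_syntax

definition doubletons :: "'a set \<Rightarrow> 'a set set" where
  "doubletons X = {A. A \<subseteq> X \<and> card A = 2}"

definition graph :: "'a set set \<Rightarrow> bool" where
  "graph E \<longleftrightarrow> (\<forall>e\<in>E. card e = 2)"

abbreviation verts :: "'a set set \<Rightarrow> 'a set" where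
  "verts E \<equiv> \<Union>E"

definition is_path :: "'a set set \<Rightarrow> 'a \<Rightarrow> 'a \<Rightarrow> nat \<Rightarrow> (nat \<Rightarrow> 'a) \<Rightarrow> bool" where
  "is_path E x y n p \<longleftrightarrow> p 0 = x \<and> p n = y \<and> (\<forall>i<n. {p i, p (Suc i)} \<in> E)"

definition connected_graph :: "'a set set \<Rightarrow> bool" where
  "connected_graph E \<longleftrightarrow>
     graph E \<and> (\<forall>x\<in>verts E. \<forall>y\<in>verts E. \<exists>n p. is_path E x y n p)"

text \<open>A function \<open>d : E \<rightarrow> [0,\<infinity>)\<close> on the edges of a graph is represented by the edge set \<open>E\<close> and a
  total function \<open>d\<close> whose values outside \<open>E\<close> are irrelevant.\<close>

text \<open>The trivial path (\<open>n = 0\<close>) is admitted, which gives \<open>dhat E d x x = 0\<close> for nonnegative \<open>d\<close>.\<close>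

definition dhat :: "'a set set \<Rightarrow> ('a set \<Rightarrow> real) \<Rightarrow> 'a \<Rightarrow> 'a \<Rightarrow> real" where
  "dhat E d x y = Inf {(\<Sum>i<n. d {p i, p (Suc i)}) | n p. is_path E x y n p}"

text \<open>The edge \<open>ab\<close> is unordered while the expression is not symmetric in \<open>a\<close> and \<open>b\<close>, so both
  orientations of every edge contribute. If \<open>d\<close> is a graph pseudometric and \<open>x\<close>, \<open>y\<close> are vertices,
  the set is bounded above by \<open>dhat E d x y\<close>, so the real-valued supremum is the true one.\<close>

definition dcheck :: "'a set set \<Rightarrow> ('a set \<Rightarrow> real) \<Rightarrow> 'a \<Rightarrow> 'a \<Rightarrow> real" where
  "dcheck E d x y =
     Sup {max 0 (d {a, b} - dhat E d a x - dhat E d y b) | a b. {a, b} \<in> E}"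

definition graph_pseudometric :: "'a set set \<Rightarrow> ('a set \<Rightarrow> real) \<Rightarrow> bool" where
  "graph_pseudometric E d \<longleftrightarrow>
     connected_graph E \<and> (\<forall>e\<in>E. 0 \<le> d e) \<and>
     (\<forall>x y. {x, y} \<in> E \<longrightarrow> d {x, y} = dhat E d x y)"

definition graph_metric :: "'a set set \<Rightarrow> ('a set \<Rightarrow> real) \<Rightarrow> bool" where
  "graph_metric E d \<longleftrightarrow>
     graph_pseudometric E d \<and> (\<forall>x y. {x, y} \<in> E \<longrightarrow> 0 < d {x, y})"

definition full_metric :: "'a set set \<Rightarrow> ('a set \<Rightarrow> real) \<Rightarrow> bool" where
  "full_metric E d \<longleftrightarrow> graph_metric E d \<and> E = doubletons (verts E)"

definition floppy :: "'a set set \<Rightarrow> ('a set \<Rightarrow> real) \<Rightarrow> bool" where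
  "floppy E d \<longleftrightarrow>
     graph_pseudometric E d \<and>
     (\<forall>x y. {x, y} \<in> doubletons (verts E) - E \<longrightarrow> dcheck E d x y < dhat E d x y)"

definition graph_of :: "'a set set \<Rightarrow> ('a set \<Rightarrow> real) \<Rightarrow> ('a set \<times> real) set" where
  "graph_of E d = {(e, d e) | e. e \<in> E}"

definition is_full_metric_rel :: "('a set \<times> real) set \<Rightarrow> bool" where
  "is_full_metric_rel D \<longleftrightarrow> (\<exists>E d. D = graph_of E d \<and> full_metric E d)"

text \<open>In the metric-extending game the ordinal \<open>lam\<close> is given by a well-order: the innings are the
  elements of \<open>Field lam\<close>, and those preceding inning \<open>\<alpha>\<close> form \<open>underS lam \<alpha>\<close>. A strategy of player I
  maps an inning \<open>\<alpha>\<close> and the sequence of earlier answers, a function with domain \<open>underS lam \<alpha>\<close>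
  (extensional, so that nothing else is visible to the player), to a pair consisting of a
  doubleton and a member of the family.\<close>

type_synonym ('i, 'a) strategy = "'i \<Rightarrow> ('i \<Rightarrow> real) \<Rightarrow> 'a set \<times> real set"

definition is_strategy ::
  "'a set set \<Rightarrow> 'i rel \<Rightarrow> real set set \<Rightarrow> ('i, 'a) strategy \<Rightarrow> bool" where
  "is_strategy E lam \<F> \<sigma> \<longleftrightarrow>
     (\<forall>\<alpha>\<in>Field lam. \<forall>s \<in> underS lam \<alpha> \<rightarrow>\<^sub>E (UNIV :: real set).
        \<sigma> \<alpha> s \<in> doubletons (verts E) \<times> \<F>)"

definition move_at :: "'i rel \<Rightarrow> ('i, 'a) strategy \<Rightarrow> ('i \<Rightarrow> real) \<Rightarrow> 'i \<Rightarrow> 'a set \<times> real set" where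
  "move_at lam \<sigma> r \<alpha> = \<sigma> \<alpha> (restrict r (underS lam \<alpha>))"

definition player_I_wins_play ::
  "'a set set \<Rightarrow> ('a set \<Rightarrow> real) \<Rightarrow> 'i rel \<Rightarrow> ('i \<Rightarrow> 'a set) \<Rightarrow> ('i \<Rightarrow> real) \<Rightarrow> bool" where
  "player_I_wins_play E d lam xy r \<longleftrightarrow>
     is_full_metric_rel (graph_of E d \<union> {(xy \<alpha>, r \<alpha>) | \<alpha>. \<alpha> \<in> Field lam})"

definition winning_strategy ::
  "'a set set \<Rightarrow> ('a set \<Rightarrow> real) \<Rightarrow> 'i rel \<Rightarrow> real set set \<Rightarrow> ('i, 'a) strategy \<Rightarrow> bool" where
  "winning_strategy E d lam \<F> \<sigma> \<longleftrightarrow>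
     is_strategy E lam \<F> \<sigma> \<and>
     (\<forall>r. (\<forall>\<alpha>\<in>Field lam. r \<alpha> \<in> snd (move_at lam \<sigma> r \<alpha>)) \<longrightarrow>
        player_I_wins_play E d lam (\<lambda>\<alpha>. fst (move_at lam \<sigma> r \<alpha>)) r)"

definition open_family :: "real set set" where
  "open_family = {U. open U \<and> U \<noteq> {} \<and> U \<subseteq> {0<..}}"

end

theory Submission
  imports Defs
begin

text \<open>If \<open>xy\<close> is a non-edge of a floppy graph metric \<open>d\<close>, then extending \<open>d\<close> to \<open>xy\<close> by any
  value strictly between \<open>dcheck x y\<close> and \<open>dhat x y\<close> gives a floppy graph metric again. Player I
  therefore enumerates the non-edges along \<open>lam\<close> and always offers the open interval between the two
  bounds computed from the current partial metric. As \<open>lam\<close> is at most \<open>\<omega>\<close>, every inning has only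
  finitely many predecessors, so floppiness is never needed at a limit stage; the polygonal
  inequality survives in the union because each path is finite and so lies in an earlier stage.\<close>

section \<open>Paths and their lengths\<close>

definition path_length :: "('a set \<Rightarrow> real) \<Rightarrow> nat \<Rightarrow> (nat \<Rightarrow> 'a) \<Rightarrow> real" where
  "path_length d n p = (\<Sum>i<n. d {p i, p (Suc i)})"

lemma is_path_mono: "is_path E x y n p \<Longrightarrow> E \<subseteq> E' \<Longrightarrow> is_path E' x y n p"
  by (auto simp: is_path_def)

lemma is_path_edge: "{x, y} \<in> E \<Longrightarrow> is_path E x y 1 (\<lambda>i. if i = 0 then x else y)"
  by (simp add: is_path_def)

lemma path_length_edge: "path_length d 1 (\<lambda>i. if i = 0 then x else y) = d {x, y}"
  by (simp add: path_length_def)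

lemma is_path_Cons:
  assumes "{x, y} \<in> E" "is_path E y z n p"
  shows "is_path E x z (Suc n) (case_nat x p)"
  using assms by (auto simp: is_path_def less_Suc_eq_0_disj split: nat.split)

lemma path_length_Cons:
  assumes "p 0 = y"
  shows "path_length d (Suc n) (case_nat x p) = d {x, y} + path_length d n p"
  using assms unfolding path_length_def sum.lessThan_Suc_shift by simp

text \<open>Triangle inequality, symmetry and the lower bound for \<open>dhat\<close> after adding an edge all come
  from this one estimate, for different potentials \<open>\<phi>\<close>.\<close>

lemma potential_le_path_length:
  fixes \<phi> :: "'a \<Rightarrow> real"
  assumes "\<And>u w. {u, w} \<in> E \<Longrightarrow> \<phi> u \<le> d {u, w} + \<phi> w" "is_path E x y n p"
  shows "\<phi> x \<le> path_length d n p + \<phi> y"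
proof -
  have "\<phi> x \<le> path_length d m p + \<phi> (p m)" if "m \<le> n" for m
    using that
  proof (induction m)
    case 0
    then show ?case using assms(2) by (simp add: path_length_def is_path_def)
  next
    case (Suc m)
    then have "{p m, p (Suc m)} \<in> E"
      using assms(2) by (simp add: is_path_def)
    then show ?case
      using Suc assms(1)[of "p m" "p (Suc m)"] by (simp add: path_length_def)
  qed
  then show ?thesis using assms(2) by (auto simp: is_path_def)
qed

section \<open>Independence of values off the edge set\<close>

lemma dhat_eq: "dhat E d x y = Inf {path_length d n p | n p. is_path E x y n p}"
  by (simp add: dhat_def path_length_def)

text \<open>No path reads a value off the edges. This later identifies the stage metric computed
  from the answers visible to player I with the one computed from the whole play.\<close>

lemma dhat_cong:
  assumes "\<And>e. e \<in> E \<Longrightarrow> d e = d' e"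
  shows "dhat E d x y = dhat E d' x y"
proof -
  have "path_length d n p = path_length d' n p" if "is_path E x y n p" for n p
    using that assms by (auto simp: path_length_def is_path_def intro!: sum.cong)
  then have "{path_length d n p | n p. is_path E x y n p} =
      {path_length d' n p | n p. is_path E x y n p}"
    by force
  then show ?thesis by (simp add: dhat_eq)
qed

lemma dcheck_cong:
  assumes "\<And>e. e \<in> E \<Longrightarrow> d e = d' e"
  shows "dcheck E d x y = dcheck E d' x y"
proof -
  have "dhat E d = dhat E d'" by (intro ext dhat_cong assms)
  then show ?thesis unfolding dcheck_def using assms by (metis (lifting))
qed

lemma graph_metric_cong:
  assumes "\<And>e. e \<in> E \<Longrightarrow> d e = d' e"
  shows "graph_metric E d \<longleftrightarrow> graph_metric E d'"
proof -
  have "dhat E d = dhat E d'" by (intro ext dhat_cong assms)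
  then show ?thesis
    using assms by (simp add: graph_metric_def graph_pseudometric_def cong: conj_cong)
qed

lemma floppy_cong:
  assumes "\<And>e. e \<in> E \<Longrightarrow> d e = d' e"
  shows "floppy E d \<longleftrightarrow> floppy E d'"
proof -
  have "dhat E d = dhat E d'" "dcheck E d = dcheck E d'"
    by (intro ext dhat_cong dcheck_cong assms; assumption)+
  then show ?thesis
    using assms by (simp add: floppy_def graph_pseudometric_def cong: conj_cong)
qed

section \<open>Distances in weighted connected graphs\<close>

text \<open>The polygonal inequality is left out on purpose: distances on an enlarged edge set must
  be handled before that inequality is established there.\<close>

locale weighted_graph =
  fixes E :: "'a set set" and d :: "'a set \<Rightarrow> real"
  assumes connected: "connected_graph E"
    and nonneg: "e \<in> E \<Longrightarrow> 0 \<le> d e"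
begin

lemma edge_verts: "{x, y} \<in> E \<Longrightarrow> x \<in> verts E \<and> y \<in> verts E"
  by blast

lemma edge_neq: "{x, y} \<in> E \<Longrightarrow> x \<noteq> y"
  using connected by (auto simp: connected_graph_def graph_def)

lemma obtain_path:
  assumes "x \<in> verts E" "y \<in> verts E"
  obtains n p where "is_path E x y n p"
  using assms connected unfolding connected_graph_def by blast

lemma path_length_nonneg: "is_path E x y n p \<Longrightarrow> 0 \<le> path_length d n p"
  using potential_le_path_length[of E "\<lambda>_. 0" d x y n p] nonneg by simp

lemma dhat_le_path_length:
  assumes "is_path E x y n p"
  shows "dhat E d x y \<le> path_length d n p"
  unfolding dhat_eq
proof (rule cInf_lower)
  show "bdd_below {path_length d n p | n p. is_path E x y n p}"
    using path_length_nonneg by (auto intro!: bdd_belowI[of _ 0])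
qed (use assms in blast)

lemma dhat_greatest:
  assumes "x \<in> verts E" "y \<in> verts E"
    and "\<And>n p. is_path E x y n p \<Longrightarrow> c \<le> path_length d n p"
  shows "c \<le> dhat E d x y"
  unfolding dhat_eq
proof (rule cInf_greatest)
  show "{path_length d n p | n p. is_path E x y n p} \<noteq> {}"
    using obtain_path[OF assms(1,2)] by blast
qed (use assms(3) in blast)

lemma dhat_nonneg: "x \<in> verts E \<Longrightarrow> y \<in> verts E \<Longrightarrow> 0 \<le> dhat E d x y"
  using dhat_greatest path_length_nonneg by blast

lemma dhat_refl: "x \<in> verts E \<Longrightarrow> dhat E d x x = 0"
  using dhat_le_path_length[of x x 0 "\<lambda>_. x"] dhat_nonneg[of x x]
  by (simp add: is_path_def path_length_def)

lemma dhat_le_edge: "{x, y} \<in> E \<Longrightarrow> dhat E d x y \<le> d {x, y}"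
  using dhat_le_path_length[OF is_path_edge] path_length_edge by metis

lemma dhat_le_edge_add:
  assumes "{u, w} \<in> E" "z \<in> verts E"
  shows "dhat E d u z \<le> d {u, w} + dhat E d w z"
proof -
  have "dhat E d u z - d {u, w} \<le> dhat E d w z"
  proof (rule dhat_greatest)
    fix n p assume p: "is_path E w z n p"
    then have "p 0 = w" by (simp add: is_path_def)
    then show "dhat E d u z - d {u, w} \<le> path_length d n p"
      using dhat_le_path_length[OF is_path_Cons[OF assms(1) p]] path_length_Cons[of p w d n u]
      by simp
  qed (use assms in auto)
  then show ?thesis by simp
qed

lemma dhat_triangle:
  assumes "x \<in> verts E" "y \<in> verts E" "z \<in> verts E"
  shows "dhat E d x z \<le> dhat E d x y + dhat E d y z"
proof -
  have "dhat E d x z - dhat E d y z \<le> dhat E d x y"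
  proof (rule dhat_greatest)
    fix n p assume "is_path E x y n p"
    then show "dhat E d x z - dhat E d y z \<le> path_length d n p"
      using potential_le_path_length[of E "\<lambda>u. dhat E d u z" d x y n p]
        dhat_le_edge_add assms by fastforce
  qed (use assms in auto)
  then show ?thesis by simp
qed

text \<open>The function \<open>dhat E d y\<close> serves as potential along a path from
  \<open>x\<close> to \<open>y\<close>; it vanishes at \<open>y\<close>, so no path has to be
  reversed.\<close>

lemma dhat_le_commute:
  assumes "x \<in> verts E" "y \<in> verts E"
  shows "dhat E d y x \<le> dhat E d x y"
proof (rule dhat_greatest)
  fix n p assume p: "is_path E x y n p"
  have "dhat E d y u \<le> d {u, w} + dhat E d y w" if "{u, w} \<in> E" for u w
    using that assms dhat_triangle[of y w u] dhat_le_edge[of w u]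
    by (fastforce simp: insert_commute)
  then show "dhat E d y x \<le> path_length d n p"
    using potential_le_path_length[of E "dhat E d y" d x y n p] p dhat_refl assms by fastforce
qed (use assms in auto)

lemma dhat_commute: "x \<in> verts E \<Longrightarrow> y \<in> verts E \<Longrightarrow> dhat E d y x = dhat E d x y"
  using dhat_le_commute by (meson order_antisym)

text \<open>The polygonal inequality and two triangle inequalities bound every term by
  \<open>dhat E d x y\<close>, so the supremum is taken over a bounded set.\<close>

lemma dcheck_bound:
  assumes "graph_pseudometric E d" "x \<in> verts E" "y \<in> verts E" "{a, b} \<in> E"
  shows "max 0 (d {a, b} - dhat E d a x - dhat E d y b) \<le> dcheck E d x y"
  unfolding dcheck_def
proof (rule cSup_upper)
  have "d {a, b} - dhat E d a x - dhat E d y b \<le> dhat E d x y" if "{a, b} \<in> E" for a b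
  proof -
    have "d {a, b} = dhat E d a b"
      using assms(1) that by (simp add: graph_pseudometric_def)
    then show ?thesis
      using dhat_triangle[of a x b] dhat_triangle[of x y b] edge_verts[OF that] assms by simp
  qed
  then show "bdd_above {max 0 (d {a, b} - dhat E d a x - dhat E d y b) | a b. {a, b} \<in> E}"
    using dhat_nonneg[OF assms(2,3)] by (auto intro!: bdd_aboveI[of _ "dhat E d x y"])
qed (use assms in blast)

lemma dcheck_nonneg:
  assumes "graph_pseudometric E d" "x \<in> verts E" "y \<in> verts E"
  shows "0 \<le> dcheck E d x y"
proof -
  obtain e where e: "e \<in> E" using assms by blast
  then have "card e = 2" using connected by (auto simp: connected_graph_def graph_def)
  then obtain a b where "e = {a, b}" by (auto simp: card_2_iff)
  then show ?thesis using dcheck_bound[OF assms, of a b] e by simp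
qed

lemma dcheck_least:
  assumes "\<And>a b. {a, b} \<in> E \<Longrightarrow> d {a, b} - dhat E d a x - dhat E d y b \<le> c" "0 \<le> c" "E \<noteq> {}"
  shows "dcheck E d x y \<le> c"
  unfolding dcheck_def
proof (rule cSup_least)
  obtain e where e: "e \<in> E" using assms by blast
  then have "card e = 2" using connected by (auto simp: connected_graph_def graph_def)
  then obtain a b where "e = {a, b}" by (auto simp: card_2_iff)
  then show "{max 0 (d {a, b} - dhat E d a x - dhat E d y b) | a b. {a, b} \<in> E} \<noteq> {}"
    using e by blast
qed (use assms in auto)

end

lemma graph_pseudometric_weighted_graph: "graph_pseudometric E d \<Longrightarrow> weighted_graph E d"
  by (simp add: graph_pseudometric_def weighted_graph_def)

section \<open>Adding one edge to a floppy graph metric\<close>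

lemma connected_graph_extend:
  assumes "connected_graph E" "E \<subseteq> E'" "E' \<subseteq> doubletons (verts E)"
  shows "connected_graph E'" "verts E' = verts E"
proof -
  show v: "verts E' = verts E"
    using assms(2,3) by (auto simp: doubletons_def)
  have "\<exists>n p. is_path E' x y n p" if "x \<in> verts E" "y \<in> verts E" for x y
    using assms(1) that is_path_mono[OF _ assms(2)] unfolding connected_graph_def by metis
  then show "connected_graph E'"
    using assms(3) v by (auto simp: connected_graph_def graph_def doubletons_def)
qed

text \<open>A path gains nothing by crossing the new edge twice, so three routes count: avoiding it,
  or crossing it once in either direction. The disjunction lets linear arithmetic treat each route
  separately.\<close>

lemma (in weighted_graph) dhat_insert_ge:
  fixes x y :: 'a
  defines "H \<equiv> dhat E d" and "H' \<equiv> dhat (insert {x, y} E) d"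
  assumes "x \<in> verts E" "y \<in> verts E" "x \<noteq> y" "0 \<le> d {x, y}"
    and "u \<in> verts E" "v \<in> verts E"
  shows "H u v \<le> H' u v \<or> H u x + d {x, y} + H y v \<le> H' u v \<or> H u y + d {x, y} + H x v \<le> H' u v"
proof -
  \<comment> \<open>\<open>M\<close> is the cheapest of the three routes to \<open>v\<close>; it
    serves as potential for the enlarged graph.\<close>
  define M where
    "M w = min (H w v) (min (H w x + d {x, y} + H y v) (H w y + d {x, y} + H x v))" for w
  have sub: "insert {x, y} E \<subseteq> doubletons (verts E)"
    using connected assms by (auto simp: connected_graph_def graph_def doubletons_def)
  note ext = connected_graph_extend[OF connected subset_insertI sub]
  interpret E': weighted_graph "insert {x, y} E" d
    using ext assms nonneg by unfold_locales auto
  have step: "M a \<le> d {a, b} + M b" if "{a, b} \<in> insert {x, y} E" for a b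
    using that
  proof
    \<comment> \<open>Across the new edge the bound holds because a second crossing only adds
      nonnegative length.\<close>
    assume "{a, b} = {x, y}"
    then have "d {a, b} = d {x, y}" "a = x \<and> b = y \<or> a = y \<and> b = x"
      by (simp, auto simp: doubleton_eq_iff)
    moreover have "H x x = 0" "H y y = 0" "0 \<le> H x y" "0 \<le> H y x"
      using assms dhat_refl dhat_nonneg by (auto simp: H_def)
    ultimately show ?thesis
      using \<open>0 \<le> d {x, y}\<close> unfolding M_def by (elim disjE conjE; hypsubst_thin; linarith)
  next
    assume ab: "{a, b} \<in> E"
    have "H a v \<le> d {a, b} + H b v" "H a x \<le> d {a, b} + H b x" "H a y \<le> d {a, b} + H b y"
      using dhat_le_edge_add[OF ab] assms by (auto simp: H_def)
    then show ?thesis unfolding M_def by linarith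
  qed
  have "M u \<le> H' u v"
    unfolding H'_def
  proof (rule E'.dhat_greatest)
    fix n p assume "is_path (insert {x, y} E) u v n p"
    with step have "M u \<le> path_length d n p + M v"
      by (rule potential_le_path_length)
    moreover have "M v \<le> 0"
      using dhat_refl assms by (simp add: M_def)
    ultimately show "M u \<le> path_length d n p" by simp
  qed (use assms ext in auto)
  then show ?thesis by (auto simp: M_def min_def split: if_splits)
qed

text \<open>\<open>upper\<close> excludes an old route from \<open>x\<close> to \<open>y\<close>
  shorter than the new edge, and \<open>lower\<close> prevents the new edge from shortening an old
  one. Strictness of both leaves room for floppiness at the remaining non-edges.\<close>

lemma floppy_insert:
  fixes x y :: 'a
  assumes metric: "graph_metric E d" and floppy: "floppy E d"
    and xy: "{x, y} \<in> doubletons (verts E) - E"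
    and lower: "dcheck E d x y < d {x, y}" and upper: "d {x, y} < dhat E d x y"
  shows "graph_metric (insert {x, y} E) d" "floppy (insert {x, y} E) d"
proof -
  define H where "H = dhat E d"
  define H' where "H' = dhat (insert {x, y} E) d"
  define r where "r = d {x, y}"
  define V where "V = verts E"
  have psd: "graph_pseudometric E d" using metric by (simp add: graph_metric_def)
  interpret weighted_graph E d using psd by (rule graph_pseudometric_weighted_graph)
  have V: "x \<in> V" "y \<in> V" and neq: "x \<noteq> y"
    using xy by (auto simp: doubletons_def V_def)
  have Dnn: "0 \<le> dcheck E d x y" using dcheck_nonneg psd V by (simp add: V_def)
  have rpos: "0 < r" using Dnn lower by (simp add: r_def)
  have sub: "insert {x, y} E \<subseteq> doubletons (verts E)"
    using connected xy by (auto simp: connected_graph_def graph_def doubletons_def)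
  note ext = connected_graph_extend[OF connected subset_insertI sub]
  interpret E': weighted_graph "insert {x, y} E" d
    using ext rpos nonneg by unfold_locales (auto simp: r_def)
  have V': "verts (insert {x, y} E) = V" using ext by (simp add: V_def)
  have tri: "H a c \<le> H a b + H b c" if "a \<in> V" "b \<in> V" "c \<in> V" for a b c
    using dhat_triangle that by (simp add: H_def V_def)
  have com: "H a b = H b a" if "a \<in> V" "b \<in> V" for a b
    using dhat_commute that by (simp add: H_def V_def)
  have nn: "0 \<le> H a b" if "a \<in> V" "b \<in> V" for a b
    using dhat_nonneg that by (simp add: H_def V_def)
  have refl: "H a a = 0" if "a \<in> V" for a
    using dhat_refl that by (simp add: H_def V_def)
  \<comment> \<open>An infimum of positive lengths may vanish. For a non-edge, floppiness puts it
    above \<open>dcheck\<close>, which is nonnegative.\<close>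
  have pos: "0 < H a b" if "a \<in> V" "b \<in> V" "a \<noteq> b" for a b
  proof (cases "{a, b} \<in> E")
    case True
    then show ?thesis
      using metric by (metis graph_metric_def graph_pseudometric_def H_def)
  next
    case False
    then have "{a, b} \<in> doubletons (verts E) - E"
      using that by (auto simp: doubletons_def V_def)
    then have "dcheck E d a b < H a b" using floppy by (simp add: floppy_def H_def)
    then show ?thesis using dcheck_nonneg[of a b] psd that by (simp add: V_def)
  qed
  have ge: "H a b \<le> H' a b \<or> H a x + r + H y b \<le> H' a b \<or> H a y + r + H x b \<le> H' a b"
    if "a \<in> V" "b \<in> V" for a b
    using dhat_insert_ge[of x y a b] that V neq rpos
    by (simp add: V_def H_def H'_def r_def)
  have pos': "0 < H' a b" if "a \<in> V" "b \<in> V" "a \<noteq> b" for a b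
    using ge[OF that(1,2)] pos[OF that] nn[OF that(1) V(1)] nn[OF that(1) V(2)]
      nn[OF V(1) that(2)] nn[OF V(2) that(2)] rpos by linarith
  have nn': "0 \<le> H' a b" if "a \<in> V" "b \<in> V" for a b
    using E'.dhat_nonneg[of a b] that by (simp only: V' H'_def)
  have edge: "d {a, b} = H a b" if "{a, b} \<in> E" for a b
    using psd that by (simp add: graph_pseudometric_def H_def)
  have check: "d {a, b} \<le> dcheck E d u v + H a u + H v b"
    if "{a, b} \<in> E" "u \<in> V" "v \<in> V" for a b u v
    using dcheck_bound[OF psd _ _ that(1), of u v] that by (simp add: V_def H_def)
  \<comment> \<open>This is \<open>check\<close> for the reversed edge: a route from
    \<open>a\<close> to \<open>b\<close> may cross the new edge from \<open>y\<close> to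
    \<open>x\<close>.\<close>
  have check': "d {a, b} \<le> dcheck E d x y + H a y + H x b" if "{a, b} \<in> E" for a b
  proof -
    have "{b, a} \<in> E" using that by (simp add: insert_commute)
    moreover have "a \<in> V" "b \<in> V" using that by (auto simp: V_def)
    ultimately show ?thesis
      using check[of b a x y] V com[of b x] com[of y a] insert_commute[of a b "{}"] by force
  qed
  \<comment> \<open>The old pieces of a detour over the new edge fall short of
    \<open>d {a, b}\<close> by at most \<open>dcheck E d x y\<close>, which is less than
    \<open>r\<close>.\<close>
  have old: "d {a, b} = H' a b" if "{a, b} \<in> E" for a b
  proof -
    have "a \<in> V" "b \<in> V" using that by (auto simp: V_def)
    then have "d {a, b} \<le> H' a b"
      using ge[of a b] check[OF that V] check'[OF that] edge[OF that] lower
      unfolding r_def by linarith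
    then show ?thesis
      using E'.dhat_le_edge[of a b] that by (simp add: H'_def)
  qed
  have new: "r \<le> H' x y" "r \<le> H' y x"
    using ge[OF V] ge[OF V(2,1)] refl[OF V(1)] refl[OF V(2)] nn[OF V] com[OF V] upper
    unfolding r_def H_def by linarith+
  have new_eq: "H' x y = r" "H' y x = r"
    using new E'.dhat_le_edge[of x y] E'.dhat_le_edge[of y x]
    by (simp_all add: H'_def r_def insert_commute)
  have psd': "graph_pseudometric (insert {x, y} E) d"
    unfolding graph_pseudometric_def
  proof (intro conjI allI impI ballI)
    fix a b assume "{a, b} \<in> insert {x, y} E"
    then consider "{a, b} \<in> E" | "a = x" "b = y" | "a = y" "b = x"
      by (auto simp: doubleton_eq_iff)
    then show "d {a, b} = dhat (insert {x, y} E) d a b"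
      using old new_eq by cases (auto simp: r_def H'_def insert_commute)
  qed (use ext E'.nonneg in auto)
  show "graph_metric (insert {x, y} E) d"
    unfolding graph_metric_def
  proof (intro conjI allI impI psd')
    fix a b assume "{a, b} \<in> insert {x, y} E"
    then show "0 < d {a, b}"
      using metric rpos by (auto simp: graph_metric_def r_def)
  qed
  show "floppy (insert {x, y} E) d"
    unfolding floppy_def
  proof (intro conjI allI impI psd')
    fix u v assume uv: "{u, v} \<in> doubletons (verts (insert {x, y} E)) - insert {x, y} E"
    then have Vuv: "u \<in> V" "v \<in> V" and uvneq: "u \<noteq> v"
      unfolding V' by (auto simp: doubletons_def)
    have uvE: "{u, v} \<in> doubletons (verts E) - E"
      using uv ext by simp
    have ne: "\<not> (u = x \<and> v = y)" "\<not> (u = y \<and> v = x)"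
      using uv by (auto simp: insert_commute)
    \<comment> \<open>Strictness for each single edge would not survive the supremum in \<open>dcheck\<close>, hence a margin
      that is uniform over the old edges.\<close>
    define \<epsilon> where "\<epsilon> = min (H u v - dcheck E d u v) (r - dcheck E d x y)"
    have eps: "0 < \<epsilon>"
      using floppy uvE lower by (simp add: \<epsilon>_def floppy_def H_def r_def)
    have eps1: "\<epsilon> + dcheck E d u v \<le> H u v" "\<epsilon> + dcheck E d x y \<le> r"
      by (auto simp: \<epsilon>_def)
    have old_edge: "d {a, b} - H' a u - H' v b \<le> H' u v - \<epsilon>" if ab: "{a, b} \<in> E" for a b
    proof -
      have Vab: "a \<in> V" "b \<in> V" using ab by (auto simp: V_def)
      \<comment> \<open>Each of the three distances uses the new edge in one of two directions or not at all; only
        the first and the last use matter for the estimate.\<close>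
      note facts = check[OF ab Vuv] check[OF ab V] check'[OF ab] eps1 Dnn rpos
        edge[OF ab] tri[OF Vab(1) V(1) Vab(2)] tri[OF Vab(1) V(2) Vab(2)]
        tri[OF Vab(1) Vuv(1) V(1)] tri[OF Vab(1) Vuv(1) V(2)]
        tri[OF Vuv(1) Vuv(2) V(1)] tri[OF Vuv(1) Vuv(2) V(2)]
        tri[OF V(1) Vuv(2) Vab(2)] tri[OF V(2) Vuv(2) Vab(2)]
        tri[OF V(1) Vuv(1) Vuv(2)] tri[OF V(2) Vuv(1) Vuv(2)]
        nn[OF Vuv(1) V(1)] nn[OF Vuv(1) V(2)] nn[OF V(1) Vuv(1)] nn[OF V(2) Vuv(1)]
        nn[OF Vuv(2) V(1)] nn[OF Vuv(2) V(2)] nn[OF V(1) Vuv(2)] nn[OF V(2) Vuv(2)]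
      show ?thesis
        using ge[OF Vab(1) Vuv(1)] ge[OF Vuv] ge[OF Vuv(2) Vab(2)]
        by (elim disjE) (use facts in linarith)+
    qed
    \<comment> \<open>The new edge adds only two terms to the supremum, and strict inequalities
      survive a finite maximum, so a bare strict bound suffices.\<close>
    have new_edge: "r < H' p u + H' u v + H' v q"
      if pq: "p = x \<and> q = y \<or> p = y \<and> q = x" for p q
    proof -
      have Vpq: "p \<in> V" "q \<in> V" using pq V by auto
      have H: "r < H p q" using pq upper com[OF V] unfolding H_def r_def by metis
      \<comment> \<open>\<open>H u x\<close> and \<open>H y v\<close> cannot both vanish, since then
        \<open>{u, v}\<close> would be the new edge; the same argument gives
        \<open>2\<close>.\<close>
      have 1: "r < H u x + r + H y v"
      proof (cases "u = x")
        case True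
        then show ?thesis using ne pos[of y v] V Vuv nn[of u x] by fastforce
      next
        case False
        then show ?thesis using pos[of u x] V Vuv nn[of y v] by fastforce
      qed
      have 2: "r < H u y + r + H x v"
      proof (cases "u = y")
        case True
        then show ?thesis using ne pos[of x v] V Vuv nn[of u y] by fastforce
      next
        case False
        then show ?thesis using pos[of u y] V Vuv nn[of x v] by fastforce
      qed
      note facts = 1 2 H pos'[OF Vuv uvneq] nn'[OF Vpq(1) Vuv(1)] nn'[OF Vuv(2) Vpq(2)]
        tri[OF Vpq(1) Vuv(1) Vpq(2)] tri[OF Vuv Vpq(2)]
        nn[OF Vpq(1) V(1)] nn[OF Vpq(1) V(2)] nn[OF V(1) Vpq(2)] nn[OF V(2) Vpq(2)]
        nn[OF Vuv(2) V(1)] nn[OF Vuv(2) V(2)] nn[OF V(1) Vuv(1)] nn[OF V(2) Vuv(1)]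
      show ?thesis
        using ge[OF Vpq(1) Vuv(1)] ge[OF Vuv] ge[OF Vuv(2) Vpq(2)]
        by (elim disjE) (use facts in linarith)+
    qed
    \<comment> \<open>The entries of \<open>c\<close> cover the truncation at 0, all old edges with
      their common margin, and the two orientations of the new edge.\<close>
    define c where
      "c = max (max 0 (H' u v - \<epsilon>)) (max (r - H' x u - H' v y) (r - H' y u - H' v x))"
    have "dcheck (insert {x, y} E) d u v \<le> c"
    proof (rule E'.dcheck_least)
      fix a b assume "{a, b} \<in> insert {x, y} E"
      then consider "{a, b} \<in> E" | "a = x" "b = y" | "a = y" "b = x"
        by (auto simp: doubleton_eq_iff)
      then show "d {a, b} - dhat (insert {x, y} E) d a u - dhat (insert {x, y} E) d v b \<le> c"
        unfolding H'_def[symmetric]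
        using old_edge by cases (force simp: c_def r_def insert_commute)+
    qed (auto simp: c_def)
    also have "c < H' u v"
      using new_edge[of x y] new_edge[of y x] eps pos'[OF Vuv uvneq] by (auto simp: c_def)
    finally show "dcheck (insert {x, y} E) d u v < dhat (insert {x, y} E) d u v"
      by (simp add: H'_def)
  qed
qed

section \<open>Passage to the union of the stages\<close>

text \<open>The polygonal inequality compares one edge with one path at a time, hence involves
  finitely many doubletons; a single intermediate graph metric containing them settles it.\<close>

lemma full_metric_doubletons:
  assumes metric: "graph_metric E d"
    and finitary: "\<And>A. finite A \<Longrightarrow> A \<subseteq> doubletons (verts E) \<Longrightarrow>
      \<exists>E'. E \<subseteq> E' \<and> A \<subseteq> E' \<and> graph_metric E' d"
  shows "full_metric (doubletons (verts E)) d"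
proof -
  let ?W = "doubletons (verts E)"
  have con: "connected_graph E"
    using metric by (simp add: graph_metric_def graph_pseudometric_def)
  have sub: "E \<subseteq> ?W"
    using con by (auto simp: connected_graph_def graph_def doubletons_def)
  note ext = connected_graph_extend[OF con sub order_refl]
  have pos: "0 < d e" if e: "e \<in> ?W" for e
  proof -
    obtain E' where "e \<in> E'" "graph_metric E' d" using finitary[of "{e}"] e by auto
    moreover obtain a b where "e = {a, b}"
      using e by (auto simp: doubletons_def card_2_iff)
    ultimately show ?thesis by (auto simp: graph_metric_def)
  qed
  interpret W: weighted_graph ?W d
    using ext pos by unfold_locales (auto intro: less_imp_le)
  have eq: "d {x, y} = dhat ?W d x y" if xy: "{x, y} \<in> ?W" for x y
  proof (rule order_antisym)
    show "d {x, y} \<le> dhat ?W d x y"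
    proof (rule W.dhat_greatest)
      fix n p assume p: "is_path ?W x y n p"
      \<comment> \<open>The edge \<open>{x, y}\<close> is included so that the polygonal inequality
        of \<open>E'\<close> applies to it.\<close>
      let ?A = "insert {x, y} ((\<lambda>i. {p i, p (Suc i)}) ` {..<n})"
      have "?A \<subseteq> ?W" using xy p by (auto simp: is_path_def)
      then obtain E' where E': "?A \<subseteq> E'" "graph_metric E' d"
        using finitary[of ?A] by auto
      then interpret E': weighted_graph E' d
        by (simp add: graph_metric_def graph_pseudometric_weighted_graph)
      have "is_path E' x y n p" using p E'(1) by (auto simp: is_path_def)
      then have "dhat E' d x y \<le> path_length d n p" by (rule E'.dhat_le_path_length)
      then show "d {x, y} \<le> path_length d n p"
        using E' by (simp add: graph_metric_def graph_pseudometric_def)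
    qed (use W.edge_verts[OF xy] in auto)
  qed (use W.dhat_le_edge xy in blast)
  then have "graph_pseudometric ?W d"
    using W.connected W.nonneg by (simp add: graph_pseudometric_def)
  then show ?thesis
    using ext(2) pos by (simp only: full_metric_def graph_metric_def) blast
qed

section \<open>Initial segments of the natural numbers\<close>

text \<open>Finitely many indices cover \<open>A\<close> outside \<open>B\<close>, and the largest
  of them determines \<open>m\<close>. As \<open>I\<close> may be finite, \<open>{..<m}\<close> is
  required to stay inside it.\<close>

lemma finite_subset_initial_segment:
  fixes h :: "nat \<Rightarrow> 'b"
  assumes "finite A" "A \<subseteq> B \<union> h ` I" "\<And>i. i \<in> I \<Longrightarrow> {..<i} \<subseteq> I"
  shows "\<exists>m. {..<m} \<subseteq> I \<and> A \<subseteq> B \<union> h ` {..<m}"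
  using assms(1,2)
proof (induction A)
  case empty
  show ?case by (intro exI[of _ 0]) simp
next
  case (insert a A)
  then obtain m where m: "{..<m} \<subseteq> I" "A \<subseteq> B \<union> h ` {..<m}" by auto
  show ?case
  proof (cases "a \<in> B")
    case True
    with m show ?thesis by (intro exI[of _ m]) auto
  next
    case False
    then obtain i where i: "i \<in> I" "a = h i" using insert.prems by auto
    have "{..<max m (Suc i)} \<subseteq> I"
      using m(1) i(1) assms(3)[OF i(1)] by (auto simp: less_Suc_eq max_def split: if_splits)
    moreover have "insert a A \<subseteq> B \<union> h ` {..<max m (Suc i)}"
      using m(2) i(2) by fastforce
    ultimately show ?thesis by blast
  qed
qed

text \<open>An embedding into \<open>natLeq\<close> preserves initial segments, so it sends each
  inning to the number of its predecessors.\<close>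

lemma ordLeq_natLeq_embed:
  fixes lam :: "'i rel"
  assumes "lam \<le>o natLeq"
  obtains f :: "'i \<Rightarrow> nat"
  where "inj_on f (Field lam)" "\<And>\<alpha>. \<alpha> \<in> Field lam \<Longrightarrow> f ` underS lam \<alpha> = {..<f \<alpha>}"
proof -
  obtain f where wo: "Well_order lam" and emb: "embed lam natLeq f"
    using assms by (auto simp: ordLeq_def)
  have "inj_on f (Field lam)" using embed_inj_on[OF wo emb] .
  moreover have "f ` underS lam \<alpha> = {..<f \<alpha>}" if "\<alpha> \<in> Field lam" for \<alpha>
    using embed_underS[OF wo emb that] natLeq_underS_less[of "f \<alpha>"]
    by (auto simp: bij_betw_def)
  ultimately show ?thesis using that by blast
qed

section \<open>The strategy of player I\<close>

theorem theorem1p8: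
  fixes E :: "'a set set" and d :: "'a set \<Rightarrow> real" and lam :: "'i rel"
  assumes "graph_metric E d" and "floppy E d"
    and "lam =o |doubletons (verts E) - E|"
    and "lam \<le>o natLeq"
  shows "\<exists>\<sigma>. winning_strategy E d lam open_family \<sigma>"
proof -
  let ?W = "doubletons (verts E)"
  let ?I = "Field lam"
  obtain f :: "'i \<Rightarrow> nat" where inj: "inj_on f ?I"
    and f: "\<And>\<alpha>. \<alpha> \<in> ?I \<Longrightarrow> f ` underS lam \<alpha> = {..<f \<alpha>}"
    using ordLeq_natLeq_embed[OF assms(4)] by blast
  \<comment> \<open>The isomorphism with the cardinal order yields the enumeration of the non-edges
    along the innings.\<close>
  obtain e where e: "bij_betw e ?I (?W - E)"
    using assms(3) by (auto simp: ordIso_def iso_def Field_card_of)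
  have con: "connected_graph E"
    using assms(1) by (simp add: graph_metric_def graph_pseudometric_def)
  have sub: "E \<subseteq> ?W"
    using con by (auto simp: connected_graph_def graph_def doubletons_def)
  have eW: "e \<alpha> \<in> ?W - E" if "\<alpha> \<in> ?I" for \<alpha>
    using e that by (auto simp: bij_betw_def)
  have "\<exists>a b. e \<alpha> = {a, b}" if "\<alpha> \<in> ?I" for \<alpha>
    using eW[OF that] by (auto simp: doubletons_def card_2_iff)
  then obtain x y where xy: "\<And>\<alpha>. \<alpha> \<in> ?I \<Longrightarrow> e \<alpha> = {x \<alpha>, y \<alpha>}" by metis
  have uI: "underS lam \<alpha> \<subseteq> ?I" for \<alpha> by (auto simp: underS_def Field_def)

  \<comment> \<open>\<open>G S\<close> is the edge set once the innings in \<open>S\<close> are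
    answered. One function \<open>D s\<close> combines \<open>d\<close> with all answers, so between
    stages only the edge set grows.\<close>
  define G where "G S = E \<union> e ` S" for S
  define D where "D s A = (if A \<in> E then d A else s (the_inv_into ?I e A))"
    for s :: "'i \<Rightarrow> real" and A
  define ivl where
    "ivl s \<alpha> = {dcheck (G (underS lam \<alpha>)) (D s) (x \<alpha>) (y \<alpha>) <..<
      dhat (G (underS lam \<alpha>)) (D s) (x \<alpha>) (y \<alpha>)}" for s \<alpha>
  define good where "good S s \<longleftrightarrow> graph_metric (G S) (D s) \<and> floppy (G S) (D s)" for S s
  \<comment> \<open>A strategy must move legally even after answers that cannot occur when it is
    followed. There the interval might be empty, so all positive reals are offered instead.\<close>
  define \<sigma> :: "('i, 'a) strategy" where
    "\<sigma> \<alpha> s = (e \<alpha>, if good (underS lam \<alpha>) s then ivl s \<alpha> else {0<..})" for \<alpha> s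

  have De: "D s (e \<alpha>) = s \<alpha>" if "\<alpha> \<in> ?I" for s \<alpha>
    using eW[OF that] that e by (simp add: D_def the_inv_into_f_f bij_betw_def)
  have Gsub: "E \<subseteq> G S" "G S \<subseteq> ?W" if "S \<subseteq> ?I" for S
    using that eW sub by (auto simp: G_def)
  have Gverts: "verts (G S) = verts E" if "S \<subseteq> ?I" for S
    using connected_graph_extend(2)[OF con Gsub[OF that]] .
  have eG: "{x \<alpha>, y \<alpha>} \<in> doubletons (verts (G (underS lam \<alpha>))) - G (underS lam \<alpha>)"
    if "\<alpha> \<in> ?I" for \<alpha>
  proof -
    have "e \<alpha> \<notin> e ` underS lam \<alpha>"
      using inj_on_image_mem_iff[OF bij_betw_imp_inj_on[OF e] that uI] by (simp add: underS_def)
    then show ?thesis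
      using eW[OF that] Gverts[OF uI] xy[OF that] by (simp add: G_def)
  qed

  \<comment> \<open>Floppiness makes the interval nonempty; nonnegativity of \<open>dcheck\<close>
    keeps it within the positive reals.\<close>
  have legal: "ivl s \<alpha> \<in> open_family" if "\<alpha> \<in> ?I" "good (underS lam \<alpha>) s" for \<alpha> s
  proof -
    have fl: "floppy (G (underS lam \<alpha>)) (D s)" using that by (simp add: good_def)
    then have psd: "graph_pseudometric (G (underS lam \<alpha>)) (D s)" by (simp add: floppy_def)
    have "0 \<le> dcheck (G (underS lam \<alpha>)) (D s) (x \<alpha>) (y \<alpha>)"
      using weighted_graph.dcheck_nonneg[OF graph_pseudometric_weighted_graph[OF psd] psd]
        eG[OF that(1)] by (simp add: doubletons_def)
    moreover have "dcheck (G (underS lam \<alpha>)) (D s) (x \<alpha>) (y \<alpha>) <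
        dhat (G (underS lam \<alpha>)) (D s) (x \<alpha>) (y \<alpha>)"
      using fl eG[OF that(1)] unfolding floppy_def by blast
    ultimately show ?thesis by (auto simp: open_family_def ivl_def)
  qed
  have "is_strategy E lam open_family \<sigma>"
    unfolding is_strategy_def
  proof (intro ballI)
    fix \<alpha> s assume "\<alpha> \<in> ?I"
    moreover have "{0::real<..} \<in> open_family"
      by (auto simp: open_family_def intro: exI[of _ 1])
    ultimately show "\<sigma> \<alpha> s \<in> ?W \<times> open_family"
      using eW legal by (auto simp: \<sigma>_def)
  qed
  moreover have "player_I_wins_play E d lam (\<lambda>\<alpha>. fst (move_at lam \<sigma> r \<alpha>)) r"
    if play: "\<forall>\<alpha>\<in>?I. r \<alpha> \<in> snd (move_at lam \<sigma> r \<alpha>)" for r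
  proof -
    \<comment> \<open>The strategy sees \<open>r\<close> only on earlier innings, and these
      determine all edge values of the current stage.\<close>
    have Dcong: "D (restrict r (underS lam \<alpha>)) A = D r A" if "A \<in> G (underS lam \<alpha>)" for \<alpha> A
      using that uI De
      by (auto simp: G_def D_def the_inv_into_f_f[OF bij_betw_imp_inj_on[OF e]] subset_iff)
    have good_cong: "good (underS lam \<alpha>) (restrict r (underS lam \<alpha>)) \<longleftrightarrow> good (underS lam \<alpha>) r"
      for \<alpha>
      unfolding good_def by (intro arg_cong2[where f = "(\<and>)"] graph_metric_cong floppy_cong Dcong)
    have ivl_cong: "ivl (restrict r (underS lam \<alpha>)) \<alpha> = ivl r \<alpha>" for \<alpha>
      unfolding ivl_def
      by (intro arg_cong2[where f = greaterThanLessThan] dhat_cong dcheck_cong Dcong)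
    have answer: "r \<alpha> \<in> ivl r \<alpha>" if "\<alpha> \<in> ?I" "good (underS lam \<alpha>) r" for \<alpha>
      using play that by (auto simp: move_at_def \<sigma>_def good_cong ivl_cong)
    have step: "good (insert \<alpha> (underS lam \<alpha>)) r" if "\<alpha> \<in> ?I" "good (underS lam \<alpha>) r" for \<alpha>
    proof -
      have "D r {x \<alpha>, y \<alpha>} = r \<alpha>" using De xy that by metis
      then show ?thesis
        using floppy_insert[of "G (underS lam \<alpha>)" "D r" "x \<alpha>" "y \<alpha>"] eG[OF that(1)]
          answer[OF that] that(2) xy[OF that(1)]
        by (simp add: good_def ivl_def G_def)
    qed
    \<comment> \<open>\<open>g\<close> recovers an inning from the number of its predecessors, which
      turns the play into an induction over the natural numbers.\<close>
    define g where "g = the_inv_into ?I f"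
    have gf: "g (f \<alpha>) = \<alpha>" if "\<alpha> \<in> ?I" for \<alpha>
      using that inj by (simp add: g_def the_inv_into_f_f)
    have gu: "g ` {..<f \<alpha>} = underS lam \<alpha>" if "\<alpha> \<in> ?I" for \<alpha>
      using f[OF that] gf uI by (force simp flip: f[OF that])
    have initial: "{..<i} \<subseteq> f ` ?I" if "i \<in> f ` ?I" for i
      using that f uI by blast
    \<comment> \<open>The premise ends the induction with the play when \<open>lam\<close> is
      finite.\<close>
    have all_good: "good (g ` {..<m}) r" if "{..<m} \<subseteq> f ` ?I" for m
      using that
    proof (induction m)
      case 0
      have "good {} r \<longleftrightarrow> graph_metric E d \<and> floppy E d"
        using graph_metric_cong[of E "D r" d] floppy_cong[of E "D r" d]
        by (simp add: good_def G_def D_def)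
      then show ?case using assms by simp
    next
      case (Suc m)
      then obtain \<alpha> where "\<alpha> \<in> ?I" "m = f \<alpha>" by (auto simp: lessThan_Suc)
      then show ?case
        using Suc step[of \<alpha>] gu gf by (simp add: lessThan_Suc)
    qed
    have W: "?W = E \<union> e ` ?I" using e sub by (auto simp: bij_betw_def)
    also have "\<dots> = E \<union> (e \<circ> g) ` f ` ?I"
      using gf by (simp add: image_image cong: image_cong)
    finally have W': "?W = E \<union> (e \<circ> g) ` f ` ?I" .
    have metric: "graph_metric E (D r)"
      using assms(1) graph_metric_cong[of E "D r" d] by (simp add: D_def)
    have "full_metric ?W (D r)"
    proof (rule full_metric_doubletons[OF metric])
      fix A assume "finite A" "A \<subseteq> ?W"
      then obtain m where m: "{..<m} \<subseteq> f ` ?I" "A \<subseteq> E \<union> (e \<circ> g) ` {..<m}"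
        using finite_subset_initial_segment[of A E "e \<circ> g" "f ` ?I"] initial W' by auto
      have "E \<subseteq> G (g ` {..<m})" "A \<subseteq> G (g ` {..<m})"
        using m(2) by (simp_all add: G_def image_comp)
      moreover have "graph_metric (G (g ` {..<m})) (D r)"
        using all_good[OF m(1)] by (simp add: good_def)
      ultimately show "\<exists>E'. E \<subseteq> E' \<and> A \<subseteq> E' \<and> graph_metric E' (D r)"
        by blast
    qed
    \<comment> \<open>Each non-edge is chosen at exactly one inning, so the resulting relation is
      single-valued.\<close>
    moreover have "graph_of E d \<union> {(e \<alpha>, r \<alpha>) | \<alpha>. \<alpha> \<in> ?I} = graph_of ?W (D r)"
    proof -
      have "D r A = d A" if "A \<in> E" for A using that by (simp add: D_def)
      then show ?thesis unfolding W graph_of_def using De by force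
    qed
    ultimately show ?thesis
      unfolding player_I_wins_play_def is_full_metric_rel_def move_at_def \<sigma>_def fst_conv
      by blast
  qed
  ultimately show ?thesis by (auto simp: winning_strategy_def)
qed

end
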